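(* Let $k\ge 2$ be an integer. Define \[P_k(z)=\frac{(2\pi)^{2k-1}}{(2k)!}\sum_{j=0}^{k}(-1)^j B_{2j}B_{2k-2j}\binom{2k}{2j}z^{2j}+\zeta(2k-1)\left(z^{2k-1}+(-1)^k z\right)\] and \[W_{k}(z)=(2^{2k-1}+2)P_k(z)-2^{2k}P_k(z/2)- P_k(2z),\] which equals \[W_k(z)=\frac{(2\pi)^{2k-1}2^{2k}}{(2k)!}\sum_{j=0}^k (-1)^j B_{2j}B_{2k-2j} (1-2^{1-2j})(1-2^{1-2k+2j})\binom{2k}{2j} z^{2j}.\] Then all of the zeros of $W_k(z)$ lie on the unit circle $|z|=1$, and all of the zeros are simple.
   Context: $B_n$ denotes the $n$th Bernoulli number, defined by $\dfrac{t}{e^t-1}=\sum_{n\ge0}B_n\dfrac{t^n}{n!}$, and $\zeta$ is the Riemann zeta function.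
   Formalization: The closed form printed for W_k(z) is twice the defining combination (for k=2, j=0 the factors are −14 versus −7); the formal statement keeps the definition of W_k and corrects the prefactor from 2^{2k} to 2^{2k−1}. The claim on the zeros is unchanged. *)

theory Defs
  imports "HOL-Complex_Analysis.Complex_Analysis"
begin

text \<open>
  The coefficients are read off the generating function \<open>t / (e\<^sup>t - 1) = \<Sum>n. B\<^sub>n t\<^sup>n / n!\<close>.
  Division of formal power series cancels the common factor \<open>t\<close>, so this is the genuine quotient;
  in particular \<open>B\<^sub>1 = -1/2\<close>.
\<close>

definition bernoulli :: "nat \<Rightarrow> real" where
  "bernoulli n = fact n * fps_nth (fps_X / (fps_exp 1 - 1)) n"

text \<open>
  The Dirichlet series \<open>\<Sum>n\<ge>1. n\<^sup>-\<^sup>s\<close>, which is the Riemann zeta function on the half-plane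
  \<open>Re s > 1\<close>. Outside that half-plane the value is not meaningful; only \<open>s = 2k - 1\<close> with
  \<open>k \<ge> 2\<close> is used.
\<close>

definition zeta :: "complex \<Rightarrow> complex" where
  "zeta s = (\<Sum>n. 1 / of_nat (Suc n) powr s)"

definition P :: "nat \<Rightarrow> complex \<Rightarrow> complex" where
  "P k z =
     of_real ((2 * pi) ^ (2 * k - 1) / fact (2 * k)) *
       (\<Sum>j=0..k. (-1) ^ j * of_real (bernoulli (2 * j)) * of_real (bernoulli (2 * k - 2 * j)) *
          of_nat ((2 * k) choose (2 * j)) * z ^ (2 * j)) +
     zeta (of_nat (2 * k - 1)) * (z ^ (2 * k - 1) + (-1) ^ k * z)"

definition W :: "nat \<Rightarrow> complex \<Rightarrow> complex" where
  "W k z = (2 ^ (2 * k - 1) + 2) * P k z - 2 ^ (2 * k) * P k (z / 2) - P k (2 * z)"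

end

theory Submission
  imports Defs
begin

text \<open>
  Let \<open>\<eta>(s) = \<Sum>n\<ge>1. (-1)\<^sup>n\<^sup>-\<^sup>1 n\<^sup>-\<^sup>s\<close>, with \<open>\<eta>(0) = 1/2\<close>. Euler's formula for \<open>\<zeta>(2j)\<close> turns \<open>W\<^sub>k(z)\<close> into a
  nonzero multiple of \<open>Q(-z\<^sup>2)\<close>, where \<open>Q(w) = \<Sum>j\<le>k. \<eta>(2j) \<eta>(2k-2j) w\<^sup>j\<close> is self-reciprocal.
  If \<open>a\<^sub>0, \<dots>, a\<^sub>n\<close> are the coefficients of a self-reciprocal polynomial \<open>p\<close>, then
  \<open>e\<^sup>-\<^sup>i\<^sup>n\<^sup>\<phi> p(e\<^sup>2\<^sup>i\<^sup>\<phi>)\<close> is a real function \<open>T(\<phi>)\<close>, and summation by parts turns \<open>2 sin \<phi> T(\<phi>)\<close> into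
  \<open>2 a\<^sub>n sin ((n+1)\<phi>)\<close> minus a sum bounded by \<open>V = \<Sum>j<n. |a\<^sub>j\<^sub>+\<^sub>1 - a\<^sub>j|\<close>. When \<open>V < 2 |a\<^sub>n|\<close>, the signs of \<open>T\<close>
  alternate at the \<open>n+1\<close> points of \<open>(0, \<pi>)\<close> with \<open>sin ((n+1)\<phi>) = \<plusminus>1\<close>, so all \<open>n\<close> zeros of \<open>p\<close> are
  distinct and unimodular. For \<open>Q\<close>, the values \<open>\<eta>(2j)\<close> increase from \<open>1/2\<close> and stay below \<open>1\<close>, hence
  \<open>V \<le> 2 (\<eta>(2k) - 1/2) < \<eta>(2k) = 2 a\<^sub>k\<close>.
\<close>

subsection \<open>Self-reciprocal polynomials\<close>

lemma sum_mult_diff_by_parts: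
  fixes a u :: "nat \<Rightarrow> 'a :: ring"
  shows "(\<Sum>j\<le>n. a j * (u (Suc j) - u j)) =
           a n * u (Suc n) - a 0 * u 0 - (\<Sum>j<n. (a (Suc j) - a j) * u (Suc j))"
  by (induction n) (simp_all add: algebra_simps)

lemma IVT_sign_change:
  fixes f :: "real \<Rightarrow> real"
  assumes "a \<le> b" "continuous_on {a..b} f" "f a * f b < 0"
  obtains z where "a < z" "z < b" "f z = 0"
proof -
  have "\<exists>z\<ge>a. z \<le> b \<and> f z = 0"
    using assms IVT'[of f a 0 b] IVT2'[of f b 0 a] by (auto simp: mult_less_0_iff)
  then obtain z where "a \<le> z" "z \<le> b" "f z = 0"
    by blast
  moreover from this have "z \<noteq> a" "z \<noteq> b"
    using assms(3) by auto
  ultimately show ?thesis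
    by (intro that[of z]) auto
qed

lemma zeros_between_sign_changes:
  fixes f :: "real \<Rightarrow> real" and x :: "nat \<Rightarrow> real"
  assumes "strict_mono x" and "continuous_on {x 0..x n} f"
    and "\<And>m. m < n \<Longrightarrow> f (x m) * f (x (Suc m)) < 0"
  shows "\<exists>Z. finite Z \<and> card Z = n \<and> Z \<subseteq> {x 0<..<x n} \<and> (\<forall>z\<in>Z. f z = 0)"
  using assms(2,3)
proof (induction n)
  case (Suc n)
  have x: "x 0 \<le> x n" "x n < x (Suc n)"
    using assms(1) by (simp_all add: strict_mono_less strict_mono_less_eq)
  then have "continuous_on {x 0..x n} f" "continuous_on {x n..x (Suc n)} f"
    using Suc.prems(1) by (auto intro: continuous_on_subset)
  with Suc obtain Z where Z: "finite Z" "card Z = n" "Z \<subseteq> {x 0<..<x n}" "\<forall>z\<in>Z. f z = 0"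
    by auto
  obtain z where "x n < z" "z < x (Suc n)" "f z = 0"
    using IVT_sign_change[of "x n" "x (Suc n)" f] x Suc.prems(2)[of n]
      \<open>continuous_on {x n..x (Suc n)} f\<close> by auto
  moreover from this have "z \<notin> Z"
    using Z(3) by auto
  ultimately show ?case
    using Z x by (intro exI[of _ "insert z Z"]) auto
qed (auto intro: exI[of _ "{}"])

lemma inj_on_cis_double: "inj_on (\<lambda>\<phi>. cis (2 * \<phi>)) {0<..<pi}"
proof (rule inj_onI)
  fix a b assume ab: "a \<in> {0<..<pi}" "b \<in> {0<..<pi}" and "cis (2 * a) = cis (2 * b)"
  then have "sin (2 * a) = sin (2 * b) \<and> cos (2 * a) = cos (2 * b)"
    by (simp add: complex_eq_iff)
  then obtain m where m: "2 * a = 2 * b + 2 * pi * real_of_int m"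
    unfolding sin_cos_eq_iff by blast
  then have "a - b = pi * real_of_int m"
    by simp
  then have "pi * \<bar>real_of_int m\<bar> = \<bar>a - b\<bar>"
    by (simp add: abs_mult)
  also have "\<dots> < pi * 1"
    using ab by auto
  finally have "m = 0"
    unfolding mult_less_cancel_left_pos[OF pi_gt_zero] by simp
  with m show "a = b"
    by simp
qed

lemma rsquarefree_of_degree_many_roots:
  fixes p :: "'a :: idom poly"
  assumes "p \<noteq> 0" and R: "finite R" "R \<subseteq> {x. poly p x = 0}" "card R = degree p"
  shows "{x. poly p x = 0} = R" "rsquarefree p"
proof -
  show roots: "{x. poly p x = 0} = R"
    using card_seteq[OF poly_roots_finite R(2)] card_poly_roots_bound[OF \<open>p \<noteq> 0\<close>] \<open>p \<noteq> 0\<close> R(3)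
    by auto
  have order_ge: "order x p \<ge> 1" if "x \<in> R" for x
    using that R(2) \<open>p \<noteq> 0\<close> by (auto simp: order_root Suc_le_eq)
  have "order x p = 1" if "x \<in> R" for x
  proof (rule ccontr)
    assume "order x p \<noteq> 1"
    then have "(\<Sum>y\<in>R. 1) < (\<Sum>y\<in>R. order y p)"
      using that order_ge R(1) by (intro sum_strict_mono_ex1) (auto intro!: bexI[of _ x] le_neq_implies_less)
    also have "\<dots> \<le> degree p"
      using sum_order_le_degree[OF \<open>p \<noteq> 0\<close>] roots by simp
    finally show False
      using R(3) by simp
  qed
  moreover have "order x p = 0" if "x \<notin> R" for x
    using that roots by (intro order_0I) blast
  ultimately show "rsquarefree p"
    using \<open>p \<noteq> 0\<close> by (auto simp: rsquarefree_def)
qed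

definition cosine_poly :: "real poly \<Rightarrow> real \<Rightarrow> real" where
  "cosine_poly p \<phi> = (\<Sum>j\<le>degree p. coeff p j * cos ((2 * real j - real (degree p)) * \<phi>))"

lemma continuous_on_cosine_poly [continuous_intros]: "continuous_on S (cosine_poly p)"
  unfolding cosine_poly_def by (intro continuous_intros)

lemma reflect_poly_fixed_coeff:
  assumes "reflect_poly p = p" "j \<le> degree p"
  shows "coeff p (degree p - j) = coeff p j"
  using assms by (metis coeff_reflect_poly not_le)

lemma poly_cis_self_reciprocal:
  fixes p :: "real poly"
  assumes "reflect_poly p = p"
  shows "poly (map_poly complex_of_real p) (cis (2 * \<phi>)) =
           cis (real (degree p) * \<phi>) * of_real (cosine_poly p \<phi>)"
proof -
  let ?n = "degree p"
  define \<theta> where "\<theta> j = (2 * real j - real ?n) * \<phi>" for j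
  have degree: "degree (map_poly complex_of_real p) = ?n"
    by (simp add: degree_map_poly)
  have "(\<Sum>j\<le>?n. coeff p j * sin (\<theta> j)) = (\<Sum>j\<le>?n. coeff p (?n - j) * sin (\<theta> (?n - j)))"
    by (rule sum.reindex_bij_witness[of _ "\<lambda>j. ?n - j" "\<lambda>j. ?n - j"]) auto
  also have "\<dots> = (\<Sum>j\<le>?n. - (coeff p j * sin (\<theta> j)))"
  proof (intro sum.cong refl)
    fix j assume "j \<in> {..?n}"
    then have "\<theta> (?n - j) = - \<theta> j"
      by (simp add: \<theta>_def of_nat_diff algebra_simps)
    then show "coeff p (?n - j) * sin (\<theta> (?n - j)) = - (coeff p j * sin (\<theta> j))"
      using reflect_poly_fixed_coeff[OF assms] \<open>j \<in> {..?n}\<close> by simp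
  qed
  finally have "(\<Sum>j\<le>?n. coeff p j * sin (\<theta> j)) = 0"
    by (simp add: sum_negf)
  then have real: "(\<Sum>j\<le>?n. of_real (coeff p j) * cis (\<theta> j)) = of_real (cosine_poly p \<phi>)"
    by (simp add: complex_eq_iff cosine_poly_def \<theta>_def)
  have "poly (map_poly of_real p) (cis (2 * \<phi>)) = (\<Sum>j\<le>?n. of_real (coeff p j) * cis (2 * \<phi>) ^ j)"
    by (simp add: poly_altdef degree coeff_map_poly)
  also have "\<dots> = (\<Sum>j\<le>?n. cis (real ?n * \<phi>) * (of_real (coeff p j) * cis (\<theta> j)))"
    by (intro sum.cong refl)
       (simp add: Complex.DeMoivre cis_mult \<theta>_def algebra_simps mult.left_commute[of "cis _"])
  finally show ?thesis
    by (simp add: real flip: sum_distrib_left)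
qed

lemma sin_mult_cosine_poly:
  assumes "reflect_poly p = p"
  shows "2 * sin \<phi> * cosine_poly p \<phi> =
           2 * lead_coeff p * sin (real (Suc (degree p)) * \<phi>) -
           (\<Sum>j<degree p. (coeff p (Suc j) - coeff p j) * sin ((2 * real j + 1 - real (degree p)) * \<phi>))"
proof -
  let ?n = "degree p"
  define u where "u j = sin ((2 * real j - 1 - real ?n) * \<phi>)" for j
  have "2 * sin \<phi> * cos ((2 * real j - real ?n) * \<phi>) = u (Suc j) - u j" for j
  proof -
    have "u (Suc j) - u j = sin ((2 * real j - real ?n) * \<phi> + \<phi>) - sin ((2 * real j - real ?n) * \<phi> - \<phi>)"
      by (simp add: u_def algebra_simps)
    then show ?thesis
      by (simp add: sin_add sin_diff)
  qed
  then have "2 * sin \<phi> * cosine_poly p \<phi> = (\<Sum>j\<le>?n. coeff p j * (u (Suc j) - u j))"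
    by (simp add: cosine_poly_def sum_distrib_left mult.left_commute flip: mult.assoc)
  also have "\<dots> = lead_coeff p * u (Suc ?n) - coeff p 0 * u 0 -
      (\<Sum>j<?n. (coeff p (Suc j) - coeff p j) * u (Suc j))"
    by (rule sum_mult_diff_by_parts)
  also have "coeff p 0 = lead_coeff p"
    using reflect_poly_fixed_coeff[OF assms, of 0] by simp
  also have "u 0 = - u (Suc ?n)"
    by (simp add: u_def flip: sin_minus) (simp add: algebra_simps)
  finally show ?thesis
    by (simp add: u_def algebra_simps)
qed

definition coeff_variation :: "real poly \<Rightarrow> real" where
  "coeff_variation p = (\<Sum>j<degree p. \<bar>coeff p (Suc j) - coeff p j\<bar>)"

lemma cosine_poly_sign:
  assumes "reflect_poly p = p" and small: "coeff_variation p < 2 * \<bar>lead_coeff p\<bar>"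
    and \<phi>: "0 < \<phi>" "\<phi> < pi" and peak: "\<bar>sin (real (Suc (degree p)) * \<phi>)\<bar> = 1"
  shows "lead_coeff p * sin (real (Suc (degree p)) * \<phi>) * cosine_poly p \<phi> > 0"
proof -
  define d where "d = lead_coeff p * sin (real (Suc (degree p)) * \<phi>)"
  define E where
    "E = (\<Sum>j<degree p. (coeff p (Suc j) - coeff p j) * sin ((2 * real j + 1 - real (degree p)) * \<phi>))"
  have "\<bar>E\<bar> \<le> coeff_variation p"
    unfolding E_def coeff_variation_def
    by (intro order.trans[OF sum_abs] sum_mono) (simp add: abs_mult mult_left_le)
  also have "\<dots> < 2 * \<bar>d\<bar>"
    using small peak by (simp add: d_def abs_mult)
  finally have E: "\<bar>E\<bar> < 2 * \<bar>d\<bar>" .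
  then have "\<bar>d * E\<bar> < d * (2 * d)"
    using mult_strict_left_mono[OF E, of "\<bar>d\<bar>"] by (simp add: abs_mult mult.left_commute[of _ 2])
  moreover have "2 * sin \<phi> * cosine_poly p \<phi> = 2 * d - E"
    unfolding sin_mult_cosine_poly[OF assms(1)] by (simp add: d_def E_def)
  then have "(2 * sin \<phi>) * (d * cosine_poly p \<phi>) = d * (2 * d) - d * E"
    by (simp only: mult.left_commute[of _ d] right_diff_distrib)
  ultimately have "0 < (2 * sin \<phi>) * (d * cosine_poly p \<phi>)"
    by linarith
  then show ?thesis
    using sin_gt_zero[OF \<phi>] by (simp add: zero_less_mult_iff d_def)
qed

lemma cosine_poly_zeros:
  assumes "reflect_poly p = p" "coeff_variation p < 2 * \<bar>lead_coeff p\<bar>"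
  shows "\<exists>Z. finite Z \<and> card Z = degree p \<and> Z \<subseteq> {0<..<pi} \<and> (\<forall>\<phi>\<in>Z. cosine_poly p \<phi> = 0)"
proof -
  let ?n = "degree p"
  define x where "x m = pi * (real (2 * m + 1) / real (2 * Suc ?n))" for m
  have "strict_mono x"
    by (auto simp: strict_mono_def x_def intro!: mult_strict_left_mono divide_strict_right_mono)
  have peak: "sin (real (Suc ?n) * x m) = (-1) ^ m" for m
  proof -
    have "real (Suc ?n) * x m = real (Suc (2 * m)) * pi / 2"
      by (simp add: x_def field_simps)
    then show ?thesis
      by (simp only: sin_cos_npi)
  qed
  have x_bounds: "0 < x m" "x m < pi" if "m \<le> ?n" for m
  proof -
    have "real (2 * m + 1) / real (2 * Suc ?n) < 1"
      using that by simp
    from mult_strict_left_mono[OF this pi_gt_zero] show "x m < pi"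
      by (simp add: x_def)
  qed (simp add: x_def)
  have sign: "lead_coeff p * (-1) ^ m * cosine_poly p (x m) > 0" if "m \<le> ?n" for m
    using cosine_poly_sign[OF assms, of "x m"] x_bounds[OF that] by (simp add: peak del: of_nat_Suc)
  have "cosine_poly p (x m) * cosine_poly p (x (Suc m)) < 0" if "m < ?n" for m
    using mult_pos_pos[OF sign[of m] sign[of "Suc m"]] that
    by (auto simp: zero_less_mult_iff mult_less_0_iff)
  with \<open>strict_mono x\<close> obtain Z where
    "finite Z" "card Z = ?n" "Z \<subseteq> {x 0<..<x ?n}" "\<forall>\<phi>\<in>Z. cosine_poly p \<phi> = 0"
    using zeros_between_sign_changes[of x ?n "cosine_poly p"] continuous_on_cosine_poly by blast
  moreover have "{x 0<..<x ?n} \<subseteq> {0<..<pi}"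
    using x_bounds(1)[of 0] x_bounds(2)[of ?n] by auto
  ultimately show ?thesis
    by blast
qed

lemma self_reciprocal_poly_unit_circle:
  fixes p :: "real poly"
  assumes "reflect_poly p = p" "coeff_variation p < 2 * \<bar>lead_coeff p\<bar>"
  defines "q \<equiv> map_poly complex_of_real p"
  shows "rsquarefree q" "poly q w = 0 \<Longrightarrow> norm w = 1"
proof -
  obtain Z where Z: "finite Z" "card Z = degree p" "Z \<subseteq> {0<..<pi}" "\<forall>\<phi>\<in>Z. cosine_poly p \<phi> = 0"
    using cosine_poly_zeros[OF assms(1,2)] by blast
  define R where "R = (\<lambda>\<phi>. cis (2 * \<phi>)) ` Z"
  have "p \<noteq> 0"
    using assms(2) by (auto simp: coeff_variation_def)
  then have "q \<noteq> 0" "degree q = degree p"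
    by (simp_all add: q_def degree_map_poly map_poly_eq_0_iff)
  moreover have "finite R" "card R = degree p"
    using Z by (simp_all add: R_def card_image inj_on_subset[OF inj_on_cis_double])
  moreover have "R \<subseteq> {w. poly q w = 0}"
    using Z(4) by (auto simp: R_def q_def poly_cis_self_reciprocal[OF assms(1)])
  ultimately have roots: "{w. poly q w = 0} = R" and sqf: "rsquarefree q"
    using rsquarefree_of_degree_many_roots[of q R] by auto
  show "rsquarefree q"
    by (rule sqf)
  show "norm w = 1" if "poly q w = 0"
  proof -
    have "w \<in> R"
      using that roots by blast
    then show ?thesis
      by (auto simp: R_def)
  qed
qed

subsection \<open>Euler's formula for the even zeta values\<close>

lemma Digamma_reflection_complex:
  fixes z :: complex
  assumes "z \<notin> \<int>"
  shows "Digamma (1 - z) - Digamma z = of_real pi * cot (of_real pi * z)"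
proof -
  let ?F = "\<lambda>w. of_real pi / sin (of_real pi * w)"
  have sin: "sin (of_real pi * z) \<noteq> 0"
    using assms by (auto simp: sin_eq_0 mult.commute)
  have "1 - z \<notin> \<int>"
    using assms Ints_diff[OF Ints_1, of "1 - z"] by auto
  then have "z \<notin> \<int>\<^sub>\<le>\<^sub>0" "1 - z \<notin> \<int>\<^sub>\<le>\<^sub>0"
    using assms nonpos_Ints_Int by blast+
  then have "((\<lambda>w. Gamma w * Gamma (1 - w)) has_field_derivative
          (Gamma z * Gamma (1 - z)) * (Digamma z - Digamma (1 - z))) (at z)"
    by (auto intro!: derivative_eq_intros simp: algebra_simps)
  then have "(?F has_field_derivative ?F z * (Digamma z - Digamma (1 - z))) (at z)"
    unfolding Gamma_reflection_complex .
  moreover have "(?F has_field_derivative ?F z * - (of_real pi * cot (of_real pi * z))) (at z)"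
    using sin by (auto intro!: derivative_eq_intros simp: cot_def power2_eq_square)
  ultimately have "?F z * (Digamma z - Digamma (1 - z)) = ?F z * - (of_real pi * cot (of_real pi * z))"
    by (rule DERIV_unique)
  moreover have "?F z \<noteq> 0"
    using sin by simp
  ultimately have "Digamma z - Digamma (1 - z) = - (of_real pi * cot (of_real pi * z))"
    by (metis mult_left_cancel)
  then show ?thesis
    by (simp add: algebra_simps)
qed

lemma cot_mult_exp_minus_1:
  fixes z :: complex
  assumes "sin z \<noteq> 0"
  shows "cot z * (exp (2 * \<i> * z) - 1) = \<i> * (exp (2 * \<i> * z) + 1)"
proof -
  have "exp (2 * \<i> * z) = exp (\<i> * z) * exp (\<i> * z)" "exp (\<i> * z) * exp (- (\<i> * z)) = 1"
    by (simp_all add: mult_ac flip: exp_add)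
  moreover have "2 * \<i> * sin z = exp (\<i> * z) - exp (- (\<i> * z))"
    and "2 * cos z = exp (\<i> * z) + exp (- (\<i> * z))"
    by (simp_all add: sin_exp_eq cos_exp_eq)
  ultimately have "exp (2 * \<i> * z) - 1 = exp (\<i> * z) * (2 * \<i> * sin z)"
    and "exp (2 * \<i> * z) + 1 = exp (\<i> * z) * (2 * cos z)"
    by (simp_all only: distrib_left right_diff_distrib)
  then show ?thesis
    using assms by (simp add: cot_def)
qed

lemma not_Ints_if_norm_less_1:
  fixes z :: "'a :: real_normed_div_algebra"
  assumes "norm z < 1" "z \<noteq> 0"
  shows "z \<notin> \<int>"
proof
  assume "z \<in> \<int>"
  then obtain m where "z = of_int m"
    by (rule Ints_cases)
  with assms show False
    by (cases "m = 0") auto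
qed

lemma Digamma_has_fps_expansion:
  fixes z :: complex
  assumes "z \<notin> \<int>\<^sub>\<le>\<^sub>0"
  shows "(\<lambda>w. Digamma (z + w)) has_fps_expansion Abs_fps (\<lambda>n. Polygamma n z / fact n)"
proof -
  have "fps_expansion Digamma z = Abs_fps (\<lambda>n. Polygamma n z / fact n)"
    by (simp add: fps_expansion_def higher_deriv_Polygamma[OF assms])
  moreover have "Digamma analytic_on {z}"
    using assms by (intro analytic_on_Polygamma) auto
  ultimately show ?thesis
    using analytic_at_imp_has_fps_expansion by metis
qed

lemma Digamma_diff_mult_exp_minus_1:
  fixes z :: complex
  assumes "norm z < 1"
  shows "(1 + z * (Digamma (1 - z) - Digamma (1 + z))) * (exp (2 * of_real pi * \<i> * z) - 1) =
           of_real pi * \<i> * z * (exp (2 * of_real pi * \<i> * z) + 1)"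
proof (cases "z = 0")
  case False
  with assms have z: "z \<notin> \<int>"
    by (rule not_Ints_if_norm_less_1)
  then have "sin (of_real pi * z) \<noteq> 0"
    by (auto simp: sin_eq_0 mult.commute)
  from cot_mult_exp_minus_1[OF this]
  have cot: "cot (of_real pi * z) * (exp (2 * of_real pi * \<i> * z) - 1) =
      \<i> * (exp (2 * of_real pi * \<i> * z) + 1)"
    by (simp add: mult_ac)
  have "Digamma (1 + z) = Digamma z + 1 / z"
    using Digamma_plus1[OF False] by (simp only: add.commute)
  then have "Digamma (1 - z) - Digamma (1 + z) = of_real pi * cot (of_real pi * z) - 1 / z"
    using Digamma_reflection_complex[OF z] by (simp add: algebra_simps)
  then have "1 + z * (Digamma (1 - z) - Digamma (1 + z)) = of_real pi * z * cot (of_real pi * z)"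
    using False by (simp add: right_diff_distrib)
  then have "(1 + z * (Digamma (1 - z) - Digamma (1 + z))) * (exp (2 * of_real pi * \<i> * z) - 1) =
      of_real pi * z * (cot (of_real pi * z) * (exp (2 * of_real pi * \<i> * z) - 1))"
    by (simp only: mult.assoc)
  then show ?thesis
    unfolding cot by (simp only: mult_ac)
qed simp

lemma Polygamma_fps_mult_exp_minus_1:
  defines "D \<equiv> Abs_fps (\<lambda>n. Polygamma n (1 :: complex) / fact n)" and "c \<equiv> 2 * of_real pi * \<i>"
  shows "(1 + fps_X * (fps_compose D (- fps_X) - D)) * (fps_exp c - 1) =
           fps_const (c / 2) * fps_X * (fps_exp c + 1)"
proof -
  define f where "f z = (1 + z * (Digamma (1 + - z) - Digamma (1 + z))) * (exp (c * z) - 1)" for z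
  have D: "(\<lambda>z. Digamma (1 + z)) has_fps_expansion D"
    unfolding D_def by (rule Digamma_has_fps_expansion) auto
  have "((\<lambda>z. Digamma (1 + z)) \<circ> (\<lambda>z. - z)) has_fps_expansion fps_compose D (- fps_X)"
    by (intro has_fps_expansion_compose D fps_expansion_intros) simp
  then have expansion: "f has_fps_expansion (1 + fps_X * (fps_compose D (- fps_X) - D)) * (fps_exp c - 1)"
    unfolding f_def o_def by (intro fps_expansion_intros D)
  have "f z = c / 2 * z * (exp (c * z) + 1)" if "norm z < 1" for z
    using Digamma_diff_mult_exp_minus_1[OF that] by (simp add: f_def c_def)
  then have "\<forall>\<^sub>F z in nhds 0. f z = c / 2 * z * (exp (c * z) + 1)"
    by (intro eventually_nhds_in_open[of "ball 0 1", THEN eventually_mono]) auto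
  with expansion have "(\<lambda>z. c / 2 * z * (exp (c * z) + 1)) has_fps_expansion
      (1 + fps_X * (fps_compose D (- fps_X) - D)) * (fps_exp c - 1)"
    by (simp only: has_fps_expansion_cong[OF _ refl])
  moreover have "(\<lambda>z. c / 2 * z * (exp (c * z) + 1)) has_fps_expansion
      fps_const (c / 2) * fps_X * (fps_exp c + 1)"
    by (intro fps_expansion_intros)
  ultimately show ?thesis
    by (rule fps_expansion_unique_complex)
qed

lemma fps_exp_minus_1_dvd_X: "(fps_exp 1 - 1 :: 'a :: field_char_0 fps) dvd fps_X"
proof -
  have "subdegree (fps_exp 1 - 1 :: 'a fps) = 1"
    by (intro subdegreeI) (auto simp: less_Suc_eq)
  moreover from this have "(fps_exp 1 - 1 :: 'a fps) \<noteq> 0"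
    by force
  ultimately show ?thesis
    by (subst fps_dvd_iff) auto
qed

lemma bernoulli_fps_mult_exp_minus_1:
  fixes c :: "'a :: real_normed_field"
  shows "Abs_fps (\<lambda>n. of_real (bernoulli n / fact n) * c ^ n) * (fps_exp c - 1) = fps_const c * fps_X"
    (is "?B * _ = _")
proof (rule fps_ext)
  fix n
  define F :: "real fps" where "F = fps_X / (fps_exp 1 - 1)"
  have F: "F * (fps_exp 1 - 1) = fps_X"
    unfolding F_def by (rule dvd_div_mult_self[OF fps_exp_minus_1_dvd_X])
  have "fps_nth (?B * (fps_exp c - 1)) n = c ^ n * of_real (fps_nth (F * (fps_exp 1 - 1)) n)"
    unfolding fps_mult_nth of_real_sum sum_distrib_left
  proof (intro sum.cong refl)
    fix i assume "i \<in> {0..n}"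
    then have "c ^ n = c ^ i * c ^ (n - i)"
      by (simp flip: power_add)
    then show "fps_nth ?B i * fps_nth (fps_exp c - 1) (n - i) =
        c ^ n * of_real (fps_nth F i * fps_nth (fps_exp 1 - 1) (n - i))"
      by (simp add: bernoulli_def F_def field_simps)
  qed
  then show "fps_nth (?B * (fps_exp c - 1)) n = fps_nth (fps_const c * fps_X) n"
    unfolding F by (cases "n = 1") auto
qed

lemma Polygamma_odd_1_eq_bernoulli:
  assumes "j \<ge> 1"
  shows "Polygamma (2 * j - 1) (1 :: real) / fact (2 * j - 1) =
           (-1) ^ (j + 1) * (2 * pi) ^ (2 * j) * bernoulli (2 * j) / (2 * fact (2 * j))"
proof -
  define c where "c = 2 * complex_of_real pi * \<i>"
  define D where "D = Abs_fps (\<lambda>n. Polygamma n (1 :: complex) / fact n)"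
  define B where "B = Abs_fps (\<lambda>n. complex_of_real (bernoulli n / fact n) * c ^ n)"
  have "fps_nth (fps_exp c - 1) 1 \<noteq> fps_nth 0 1"
    by (simp add: c_def)
  then have nonzero: "fps_exp c - 1 \<noteq> 0"
    by metis
  have "(1 + fps_X * (fps_compose D (- fps_X) - D)) * (fps_exp c - 1) =
      fps_const (c / 2) * fps_X * (fps_exp c - 1) + fps_const c * fps_X"
    unfolding D_def c_def Polygamma_fps_mult_exp_minus_1 by (simp add: algebra_simps flip: fps_const_mult)
  also have "\<dots> = (fps_const (c / 2) * fps_X + B) * (fps_exp c - 1)"
    by (simp only: B_def distrib_right bernoulli_fps_mult_exp_minus_1)
  finally have "1 + fps_X * (fps_compose D (- fps_X) - D) = fps_const (c / 2) * fps_X + B"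
    using nonzero by simp
  from arg_cong[OF this, of "\<lambda>F. fps_nth F (2 * j)"]
  have "- 2 * complex_of_real (Polygamma (2 * j - 1) 1 / fact (2 * j - 1)) =
      of_real (bernoulli (2 * j) / fact (2 * j)) * c ^ (2 * j)"
    using assms Polygamma_of_real[of 1 "2 * j - 1", where 'a = complex]
    by (simp add: D_def B_def fps_compose_uminus')
  also have "c ^ (2 * j) = of_real ((-1) ^ j * (2 * pi) ^ (2 * j))"
  proof -
    have "c\<^sup>2 = of_real (- 1 * (2 * pi)\<^sup>2)"
      by (simp add: c_def power_mult_distrib)
    then show ?thesis
      unfolding power_mult power_mult_distrib[symmetric] by (simp del: of_real_mult)
  qed
  finally have "complex_of_real (- 2 * (Polygamma (2 * j - 1) 1 / fact (2 * j - 1))) =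
      of_real (bernoulli (2 * j) / fact (2 * j) * ((-1) ^ j * (2 * pi) ^ (2 * j)))"
    by simp
  then show ?thesis
    unfolding of_real_eq_iff by (simp add: field_simps)
qed

lemma Euler_even_zeta_sums:
  assumes "j \<ge> 1"
  shows "(\<lambda>n. 1 / real (Suc n) ^ (2 * j)) sums
           ((-1) ^ (j + 1) * (2 * pi) ^ (2 * j) * bernoulli (2 * j) / (2 * fact (2 * j)))"
  using Polygamma_LIMSEQ[of "1 :: real" "2 * j - 1"] assms
  unfolding Polygamma_odd_1_eq_bernoulli[OF assms, symmetric]
  by (simp add: inverse_eq_divide)

subsection \<open>The alternating zeta function at even integers\<close>

text \<open>
  At \<open>0\<close> the series does not converge, and the value is that of its analytic continuation.
\<close>

definition eta :: "nat \<Rightarrow> real" where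
  "eta n = (if n = 0 then 1 / 2 else (\<Sum>m. (-1) ^ m * (1 / real (Suc m) ^ n)))"

lemma eta_alternating_series:
  assumes "n \<ge> 1"
  shows eta_sums: "(\<lambda>m. (-1) ^ m * (1 / real (Suc m) ^ n)) sums eta n"
    and eta_ge: "eta n \<ge> 1 - 1 / 2 ^ n"
    and eta_le: "eta n \<le> 1 - 1 / 2 ^ n + 1 / 3 ^ n"
proof -
  define a where "a m = 1 / real (Suc m) ^ n" for m
  have eta: "eta n = (\<Sum>m. (-1) ^ m * a m)"
    using assms by (simp add: eta_def a_def)
  have "(\<lambda>m. inverse (real (Suc m)) ^ n) \<longlonglongrightarrow> 0"
    using assms by (intro tendsto_null_power LIMSEQ_inverse_real_of_nat) simp
  then have "a \<longlonglongrightarrow> 0"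
    unfolding a_def by (simp only: inverse_eq_divide power_one_over)
  moreover have "a m \<ge> 0" "a (Suc m) \<le> a m" for m
    by (auto simp: a_def intro!: divide_left_mono power_mono)
  ultimately have leibniz: "summable (\<lambda>m. (-1) ^ m * a m)"
    "(\<Sum>m<2 * 1. (-1) ^ m * a m) \<le> (\<Sum>m. (-1) ^ m * a m)"
    "(\<Sum>m. (-1) ^ m * a m) \<le> (\<Sum>m<2 * 1 + 1. (-1) ^ m * a m)"
    by (rule summable_Leibniz')+
  show "(\<lambda>m. (-1) ^ m * (1 / real (Suc m) ^ n)) sums eta n"
    using leibniz(1) unfolding eta a_def by (rule summable_sums)
  show "eta n \<ge> 1 - 1 / 2 ^ n" "eta n \<le> 1 - 1 / 2 ^ n + 1 / 3 ^ n"
    using leibniz(2,3) by (simp_all add: eta a_def numeral_2_eq_2 numeral_3_eq_3)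
qed

lemma eta_eq_zeta_sum:
  assumes "n \<ge> 1" "(\<lambda>m. 1 / real (Suc m) ^ n) sums s"
  shows "eta n = (1 - 2 / 2 ^ n) * s"
proof -
  define f where "f m = 1 / real (Suc m) ^ n" for m
  have f: "f sums s"
    unfolding f_def by (rule assms(2))
  have "f (2 * m + 1) = f m / 2 ^ n" for m
  proof -
    have "real (Suc (2 * m + 1)) = 2 * real (Suc m)"
      by simp
    then show ?thesis
      by (simp add: f_def power_mult_distrib del: of_nat_Suc)
  qed
  then have "(\<lambda>m. (\<lambda>i. if odd i then f i else 0) (2 * m + 1)) sums (s / 2 ^ n)"
    using sums_divide[OF f] by simp
  then have "(\<lambda>m. if odd m then f m else 0) sums (s / 2 ^ n)"
    by (subst (asm) sums_mono_reindex) (auto simp: strict_mono_def elim: oddE)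
  from sums_diff[OF f sums_mult[OF this, of 2]]
  have "(\<lambda>m. f m - 2 * (if odd m then f m else 0)) sums ((1 - 2 / 2 ^ n) * s)"
    by (simp add: algebra_simps)
  also have "(\<lambda>m. f m - 2 * (if odd m then f m else 0)) = (\<lambda>m. (-1) ^ m * (1 / real (Suc m) ^ n))"
    by (auto simp: f_def fun_eq_iff)
  finally show ?thesis
    using eta_sums[OF assms(1)] sums_unique2 by blast
qed

lemma eta_even_eq_bernoulli:
  "eta (2 * j) = (-1) ^ (j + 1) * (2 * pi) ^ (2 * j) * (1 - 2 / 4 ^ j) * bernoulli (2 * j) / (2 * fact (2 * j))"
proof (cases "j = 0")
  case True
  have "bernoulli 0 = 1"
    using arg_cong[OF bernoulli_fps_mult_exp_minus_1[of "1 :: real"], of "\<lambda>F. fps_nth F 1"]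
    by (simp add: fps_mult_nth)
  with True show ?thesis
    by (simp add: eta_def)
next
  case False
  then show ?thesis
    using eta_eq_zeta_sum[OF _ Euler_even_zeta_sums, of j] by (simp add: power_mult)
qed

lemma eta_less_1: "eta n < 1"
proof (cases "n = 0")
  case False
  have "(1 :: real) / 3 ^ n < 1 / 2 ^ n"
    using False by (intro divide_strict_left_mono power_strict_mono) auto
  then show ?thesis
    using eta_le[of n] False by simp
qed (simp add: eta_def)

lemma mono_eta_even: "mono (\<lambda>j. eta (2 * j))"
proof (rule incseq_SucI)
  fix j
  have ge: "eta (2 * Suc j) \<ge> 1 - (1 / 4) ^ Suc j"
    using eta_ge[of "2 * Suc j"] by (simp add: power_mult power_divide)
  show "eta (2 * j) \<le> eta (2 * Suc j)"
  proof (cases "j = 0")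
    case True
    then show ?thesis
      using ge by (simp add: eta_def)
  next
    case False
    have "eta (2 * j) \<le> 1 - (1 / 4) ^ j + (1 / 9) ^ j"
      using eta_le[of "2 * j"] False by (simp add: power_mult power_divide)
    also have "(1 / 9 :: real) ^ j = (4 / 9) ^ j * (1 / 4) ^ j"
      by (simp flip: power_mult_distrib)
    also have "\<dots> \<le> (4 / 9) ^ 1 * (1 / 4) ^ j"
      using False by (intro mult_right_mono power_decreasing) auto
    also have "1 - (1 / 4) ^ j + (4 / 9) ^ 1 * (1 / 4 :: real) ^ j \<le> 1 - (1 / 4) ^ Suc j"
      by simp
    also note ge
    finally show ?thesis
      by simp
  qed
qed

lemma eta_even_ge_half: "eta (2 * j) \<ge> 1 / 2"
  using monoD[OF mono_eta_even, of 0 j] by (simp add: eta_def)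

definition eta_poly :: "nat \<Rightarrow> real poly" where
  "eta_poly k = (\<Sum>j\<le>k. monom (eta (2 * j) * eta (2 * (k - j))) j)"

lemma coeff_eta_poly: "coeff (eta_poly k) j = (if j \<le> k then eta (2 * j) * eta (2 * (k - j)) else 0)"
  by (auto simp: eta_poly_def coeff_sum)

lemma degree_eta_poly [simp]: "degree (eta_poly k) = k"
proof (rule antisym)
  show "degree (eta_poly k) \<le> k"
    by (rule degree_le) (simp add: coeff_eta_poly)
  show "k \<le> degree (eta_poly k)"
    using eta_even_ge_half[of 0] eta_even_ge_half[of k] by (intro le_degree) (simp add: coeff_eta_poly)
qed

lemma reflect_poly_eta_poly: "reflect_poly (eta_poly k) = eta_poly k"
  by (rule poly_eqI) (simp add: coeff_reflect_poly coeff_eta_poly mult.commute)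

lemma variation_convolution_le:
  fixes b :: "nat \<Rightarrow> real"
  assumes "mono b" and b: "\<And>j. 0 \<le> b j" "\<And>j. b j \<le> M"
  shows "(\<Sum>j<k. \<bar>b (Suc j) * b (k - Suc j) - b j * b (k - j)\<bar>) \<le> 2 * M * (b k - b 0)"
proof -
  define d where "d j = b (Suc j) - b j" for j
  have d: "d j \<ge> 0" for j
    using \<open>mono b\<close> by (simp add: d_def monoD)
  have "(\<Sum>j<k. \<bar>b (Suc j) * b (k - Suc j) - b j * b (k - j)\<bar>) \<le> (\<Sum>j<k. M * d j + M * d (k - Suc j))"
  proof (rule sum_mono)
    fix j assume "j \<in> {..<k}"
    then have "b (Suc j) * b (k - Suc j) - b j * b (k - j) = b (k - Suc j) * d j - b j * d (k - Suc j)"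
      by (simp add: d_def Suc_diff_Suc algebra_simps)
    also have "\<bar>\<dots>\<bar> \<le> \<bar>b (k - Suc j) * d j\<bar> + \<bar>b j * d (k - Suc j)\<bar>"
      by (rule abs_triangle_ineq4)
    also have "\<dots> \<le> M * d j + M * d (k - Suc j)"
      using b d by (intro add_mono) (simp_all add: abs_mult mult_right_mono)
    finally show "\<bar>b (Suc j) * b (k - Suc j) - b j * b (k - j)\<bar> \<le> M * d j + M * d (k - Suc j)" .
  qed
  also have "\<dots> = M * (\<Sum>j<k. d j) + M * (\<Sum>j<k. d j)"
    by (simp add: sum.distrib sum.nat_diff_reindex flip: sum_distrib_left)
  also have "(\<Sum>j<k. d j) = b k - b 0"
    by (simp add: d_def sum_lessThan_telescope)
  finally show ?thesis
    by simp
qed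

lemma coeff_variation_eta_poly_less: "coeff_variation (eta_poly k) < 2 * lead_coeff (eta_poly k)"
proof -
  have "coeff_variation (eta_poly k) =
      (\<Sum>j<k. \<bar>eta (2 * Suc j) * eta (2 * (k - Suc j)) - eta (2 * j) * eta (2 * (k - j))\<bar>)"
    by (simp add: coeff_variation_def coeff_eta_poly Suc_le_eq)
  also have "\<dots> \<le> 2 * 1 * (eta (2 * k) - eta (2 * 0))"
  proof (rule variation_convolution_le[OF mono_eta_even])
    show "0 \<le> eta (2 * j)" "eta (2 * j) \<le> 1" for j
      using eta_even_ge_half[of j] eta_less_1[of "2 * j"] by linarith+
  qed
  also have "\<dots> < eta (2 * k)"
    using eta_less_1[of "2 * k"] by (simp add: eta_def)
  also have "\<dots> = 2 * lead_coeff (eta_poly k)"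
    by (simp add: coeff_eta_poly) (simp add: eta_def)
  finally show ?thesis .
qed

lemma eta_poly_unit_circle:
  fixes k :: nat
  defines "q \<equiv> map_poly complex_of_real (eta_poly k)"
  shows "rsquarefree q" "poly q w = 0 \<Longrightarrow> norm w = 1"
proof -
  have "coeff_variation (eta_poly k) < 2 * \<bar>lead_coeff (eta_poly k)\<bar>"
    using coeff_variation_eta_poly_less[of k] by linarith
  note unit_circle = self_reciprocal_poly_unit_circle[OF reflect_poly_eta_poly this]
  show "rsquarefree q"
    unfolding q_def by (rule unit_circle(1))
  show "norm w = 1" if "poly q w = 0"
    using that unfolding q_def by (rule unit_circle(2))
qed

subsection \<open>The polynomials \<open>W\<^sub>k\<close>\<close>

text \<open>
  The operator that takes \<open>P\<^sub>k\<close> to \<open>W\<^sub>k\<close> acts diagonally on monomials; it kills \<open>z\<close> and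
  \<open>z\<^sup>2\<^sup>k\<^sup>-\<^sup>1\<close>, which removes the zeta value.
\<close>

lemma W_operator_monomial:
  fixes z :: "'a :: field_char_0"
  assumes "k \<ge> 1"
  shows "(2 ^ (2 * k - 1) + 2) * z ^ n - 2 ^ (2 * k) * (z / 2) ^ n - (2 * z) ^ n =
           2 ^ (2 * k - 1) * (1 - 2 powi (1 - int n)) * (1 - 2 powi (1 - 2 * int k + int n)) * z ^ n"
proof -
  have "(2 :: 'a) powi (1 - int n) = 2 / 2 ^ n"
    by (simp add: power_int_diff)
  moreover have "(2 :: 'a) powi (1 - 2 * int k + int n) = 2 * 2 ^ n / 2 ^ (2 * k)"
    using power_int_of_nat[of "2 :: 'a" "2 * k"] by (simp add: power_int_diff power_int_add)
  moreover have "(2 :: 'a) ^ (2 * k) = 2 * 2 ^ (2 * k - 1)"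
    using assms by (simp flip: power_Suc)
  ultimately show ?thesis
    by (simp add: power_divide power_mult_distrib field_simps)
qed

lemma W_closed_form:
  assumes "k \<ge> 1"
  shows "W k z = of_real ((2 * pi) ^ (2 * k - 1) * 2 ^ (2 * k - 1) / fact (2 * k)) *
              (\<Sum>j=0..k. (-1) ^ j * of_real (bernoulli (2 * j)) * of_real (bernoulli (2 * k - 2 * j)) *
                 (1 - 2 powi (1 - 2 * int j)) * (1 - 2 powi (1 - 2 * int k + 2 * int j)) *
                 of_nat ((2 * k) choose (2 * j)) * z ^ (2 * j))"
proof -
  define K where "K = complex_of_real ((2 * pi) ^ (2 * k - 1) / fact (2 * k))"
  define c where "c j = (-1) ^ j * complex_of_real (bernoulli (2 * j)) *
    of_real (bernoulli (2 * k - 2 * j)) * of_nat ((2 * k) choose (2 * j))" for j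
  define Z where "Z = zeta (of_nat (2 * k - 1))"
  define T where "T n = (2 ^ (2 * k - 1) + 2) * z ^ n - 2 ^ (2 * k) * (z / 2) ^ n - (2 * z) ^ n" for n
  have P: "P k x = K * (\<Sum>j=0..k. c j * x ^ (2 * j)) + Z * (x ^ (2 * k - 1) + (-1) ^ k * x ^ 1)" for x
    by (simp add: P_def K_def c_def Z_def)
  have T: "T n = 2 ^ (2 * k - 1) * (1 - 2 powi (1 - int n)) * (1 - 2 powi (1 - 2 * int k + int n)) * z ^ n" for n
    unfolding T_def using assms by (rule W_operator_monomial)
  have "T (2 * k - 1) = 0" "T 1 = 0"
    using assms by (simp_all add: T of_nat_diff)
  moreover have "W k z = K * (\<Sum>j=0..k. c j * T (2 * j)) + Z * (T (2 * k - 1) + (-1) ^ k * T 1)"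
    unfolding W_def P T_def by (simp add: sum.distrib sum_subtractf sum_distrib_left algebra_simps)
  ultimately have "W k z = K * (\<Sum>j=0..k. c j * T (2 * j))"
    by simp
  then show ?thesis
    by (simp add: T K_def c_def sum_distrib_left mult_ac)
qed

lemma bernoulli_even_eq_eta:
  "bernoulli (2 * j) * (1 - 2 powi (1 - 2 * int j)) =
     - 2 * (-1) ^ j * fact (2 * j) * eta (2 * j) / (2 * pi) ^ (2 * j)"
proof -
  have "(2 :: real) powi (1 - 2 * int j) = 2 / 4 ^ j"
    using power_int_of_nat[of "2 :: real" "2 * j"] by (simp add: power_int_diff power_mult)
  then show ?thesis
    by (simp add: eta_even_eq_bernoulli)
qed

lemma bernoulli_product_eq_eta_product:
  assumes "j \<le> k"
  shows "bernoulli (2 * j) * bernoulli (2 * k - 2 * j) * (1 - 2 powi (1 - 2 * int j)) *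
           (1 - 2 powi (1 - 2 * int k + 2 * int j)) * real ((2 * k) choose (2 * j)) =
         4 * (-1) ^ k * fact (2 * k) / (2 * pi) ^ (2 * k) * (eta (2 * j) * eta (2 * (k - j)))"
proof -
  obtain i where k: "k = j + i"
    using assms le_iff_add by blast
  have "real ((2 * k) choose (2 * j)) = fact (2 * k) / (fact (2 * j) * fact (2 * i))"
    using binomial_fact[of "2 * j" "2 * k", where 'a = real] by (simp add: k)
  moreover have "(2 :: real) powi (1 - 2 * int k + 2 * int j) = 2 powi (1 - 2 * int i)"
    and "2 * k - 2 * j = 2 * i"
    by (simp_all add: k)
  ultimately have "bernoulli (2 * j) * bernoulli (2 * k - 2 * j) * (1 - 2 powi (1 - 2 * int j)) *
      (1 - 2 powi (1 - 2 * int k + 2 * int j)) * real ((2 * k) choose (2 * j)) =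
    (bernoulli (2 * j) * (1 - 2 powi (1 - 2 * int j))) * (bernoulli (2 * i) * (1 - 2 powi (1 - 2 * int i))) *
      (fact (2 * k) / (fact (2 * j) * fact (2 * i)))"
    by simp
  then show ?thesis
    unfolding bernoulli_even_eq_eta by (simp add: k power_add distrib_left mult_ac)
qed

lemma W_term_eq_eta_poly_term:
  fixes z :: complex
  assumes "j \<le> k"
  shows "(-1) ^ j * of_real (bernoulli (2 * j)) * of_real (bernoulli (2 * k - 2 * j)) *
             (1 - 2 powi (1 - 2 * int j)) * (1 - 2 powi (1 - 2 * int k + 2 * int j)) *
             of_nat ((2 * k) choose (2 * j)) * z ^ (2 * j) =
           of_real (4 * (-1) ^ k * fact (2 * k) / (2 * pi) ^ (2 * k)) *
             (of_real (coeff (eta_poly k) j) * (- z\<^sup>2) ^ j)" (is "?lhs = _")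
proof -
  have "?lhs = of_real (bernoulli (2 * j) * bernoulli (2 * k - 2 * j) * (1 - 2 powi (1 - 2 * int j)) *
      (1 - 2 powi (1 - 2 * int k + 2 * int j)) * real ((2 * k) choose (2 * j))) *
    ((-1) ^ j * z ^ (2 * j))"
    by (simp add: mult_ac)
  also have "(-1) ^ j * z ^ (2 * j) = (- z\<^sup>2) ^ j"
    by (simp add: power_mult power_minus[of "z\<^sup>2"])
  finally show ?thesis
    unfolding bernoulli_product_eq_eta_product[OF assms] using assms by (simp add: coeff_eta_poly)
qed

lemma W_eq_eta_poly:
  assumes "k \<ge> 1"
  obtains D where "D \<noteq> 0" "\<And>z. W k z = D * poly (map_poly complex_of_real (eta_poly k)) (- z\<^sup>2)"
proof
  define K where "K = (2 * pi) ^ (2 * k - 1) * 2 ^ (2 * k - 1) / fact (2 * k)"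
  define N where "N = 4 * (-1) ^ k * fact (2 * k) / (2 * pi) ^ (2 * k)"
  show "complex_of_real K * of_real N \<noteq> 0"
    by (simp add: K_def N_def)
  fix z
  have "W k z = of_real K * (\<Sum>j=0..k. of_real N * (of_real (coeff (eta_poly k) j) * (- z\<^sup>2) ^ j))"
    unfolding W_closed_form[OF assms] K_def N_def
    by (intro arg_cong2[where f = "(*)"] sum.cong refl W_term_eq_eta_poly_term) simp
  also have "\<dots> = of_real K * of_real N * poly (map_poly complex_of_real (eta_poly k)) (- z\<^sup>2)"
    by (simp add: poly_altdef degree_map_poly coeff_map_poly atLeast0AtMost flip: sum_distrib_left)
  finally show "W k z = of_real K * of_real N * poly (map_poly complex_of_real (eta_poly k)) (- z\<^sup>2)" .
qed

lemma zorder_eq_1_if_poly_neg_square: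
  fixes q :: "complex poly"
  assumes f: "\<And>z. f z = D * poly q (- z\<^sup>2)" and "D \<noteq> 0" "rsquarefree q" "f z = 0" "z \<noteq> 0"
  shows "zorder f z = 1"
proof -
  have eq: "f = (\<lambda>z. D * poly q (- z\<^sup>2))"
    using f by blast
  have "poly q (- z\<^sup>2) = 0"
    using assms by simp
  then have "poly (pderiv q) (- z\<^sup>2) \<noteq> 0"
    using \<open>rsquarefree q\<close> by (auto simp: rsquarefree_roots)
  moreover have "(f has_field_derivative D * (poly (pderiv q) (- z\<^sup>2) * - (2 * z))) (at z)"
    unfolding eq
    by (intro DERIV_cmult DERIV_chain2[OF poly_DERIV]) (auto intro!: derivative_eq_intros)
  ultimately have "deriv f z \<noteq> 0"
    using assms by (simp add: DERIV_imp_deriv)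
  moreover have "f analytic_on {z}"
    unfolding eq poly_altdef by (intro analytic_intros)
  ultimately show ?thesis
    using \<open>f z = 0\<close> by (intro zorder_zero_eqI') auto
qed

theorem theorem3:
  fixes k :: nat
  assumes "k \<ge> 2"
  shows "(\<forall>z. W k z =
            of_real ((2 * pi) ^ (2 * k - 1) * 2 ^ (2 * k - 1) / fact (2 * k)) *
              (\<Sum>j=0..k. (-1) ^ j * of_real (bernoulli (2 * j)) * of_real (bernoulli (2 * k - 2 * j)) *
                 (1 - 2 powi (1 - 2 * int j)) * (1 - 2 powi (1 - 2 * int k + 2 * int j)) *
                 of_nat ((2 * k) choose (2 * j)) * z ^ (2 * j))) \<and>
         (\<forall>z. W k z = 0 \<longrightarrow> norm z = 1 \<and> zorder (W k) z = 1)"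
proof (intro conjI allI impI W_closed_form)
  let ?q = "map_poly complex_of_real (eta_poly k)"
  show "k \<ge> 1"
    using assms by simp
  then obtain D where D: "D \<noteq> 0" "\<And>z. W k z = D * poly ?q (- z\<^sup>2)"
    using W_eq_eta_poly by blast
  fix z assume zero: "W k z = 0"
  then have "norm (- z\<^sup>2) = 1"
    using D by (intro eta_poly_unit_circle(2)[of k]) simp
  then show "norm z = 1"
    by (simp add: norm_power abs_square_eq_1)
  then have "z \<noteq> 0"
    by auto
  with D zero show "zorder (W k) z = 1"
    by (intro zorder_eq_1_if_poly_neg_square[of _ D ?q] eta_poly_unit_circle(1))
qed

end
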